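(* (Robust perfectly rational agent: $\lambda\to+\infty$ and $\mu\to-\infty$.) Setting $U(x_1)\equiv0$ and taking the limits $\lambda\to+\infty$ and $\mu\to-\infty$ in the bounded-rational action policy $p(x_1)$ (defined in the context), one obtains $p(x_1)=\delta(x_1-x_1^* )$, where $x_1^*$ is the solution of the game-theoretic minimax problem $$x_1^*=\arg\max_{x_1}\min_{x_2}U(x_2|x_1).$$
   Context: A decision-maker emits an action $x_1$ with default probability $p_0(x_1)$ and then expects an input $x_2$ with default probability $p_0(x_2|x_1)$; $U(x_1)$ and $U(x_2|x_1)$ are real-valued utilities of the two symbols. For parameters $\lambda$ (agent) and $\mu$ (environment), the bounded-rational action policy is $$p(x_1)=\frac{1}{Z_1}\,p_0(x_1)\exp\Big(\lambda\Big(U(x_1)+\tfrac1\mu\log\sum_{x_2}p_0(x_2|x_1)\exp\big(\mu U(x_2|x_1)\big)\Big)\Big),$$ where $Z_1$ is the normalization constant. $\delta(x_1-x_1^* )$ denotes the distribution concentrated at $x_1^*$. *)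

theory Defs
  imports "HOL-Probability.Probability_Mass_Function"
begin

text \<open>
  The alphabets are the supports of the default distributions: \<open>x1\<close> ranges over
  \<open>set_pmf p0\<close> and, after \<open>x1\<close>, \<open>x2\<close> ranges over \<open>set_pmf (q0 x1)\<close>, where \<open>q0 x1\<close> is
  \<open>p0(\<cdot>|x1)\<close>. Symbols of default probability zero contribute nothing to the policy,
  so they must not take part in the minimax problem either. \<open>U2 x1 x2\<close> is \<open>U(x2|x1)\<close>;
  \<open>l\<close> and \<open>m\<close> are the agent and environment parameters (\<open>\<lambda>\<close> and \<open>\<mu>\<close>).
\<close>

definition certainty_equivalent ::
    "('a \<Rightarrow> 'b pmf) \<Rightarrow> ('a \<Rightarrow> 'b \<Rightarrow> real) \<Rightarrow> real \<Rightarrow> 'a \<Rightarrow> real" where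
  "certainty_equivalent q0 U2 m x1 =
     1 / m * ln (\<Sum>x2\<in>set_pmf (q0 x1). pmf (q0 x1) x2 * exp (m * U2 x1 x2))"

definition unnormalized_policy ::
    "'a pmf \<Rightarrow> ('a \<Rightarrow> 'b pmf) \<Rightarrow> ('a \<Rightarrow> real) \<Rightarrow> ('a \<Rightarrow> 'b \<Rightarrow> real) \<Rightarrow> real \<Rightarrow> real \<Rightarrow> 'a \<Rightarrow> real" where
  "unnormalized_policy p0 q0 U1 U2 l m x1 =
     pmf p0 x1 * exp (l * (U1 x1 + certainty_equivalent q0 U2 m x1))"

definition partition_sum ::
    "'a pmf \<Rightarrow> ('a \<Rightarrow> 'b pmf) \<Rightarrow> ('a \<Rightarrow> real) \<Rightarrow> ('a \<Rightarrow> 'b \<Rightarrow> real) \<Rightarrow> real \<Rightarrow> real \<Rightarrow> real" where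
  "partition_sum p0 q0 U1 U2 l m = (\<Sum>x1\<in>set_pmf p0. unnormalized_policy p0 q0 U1 U2 l m x1)"

definition policy ::
    "'a pmf \<Rightarrow> ('a \<Rightarrow> 'b pmf) \<Rightarrow> ('a \<Rightarrow> real) \<Rightarrow> ('a \<Rightarrow> 'b \<Rightarrow> real) \<Rightarrow> real \<Rightarrow> real \<Rightarrow> 'a \<Rightarrow> real" where
  "policy p0 q0 U1 U2 l m x1 =
     1 / partition_sum p0 q0 U1 U2 l m * unnormalized_policy p0 q0 U1 U2 l m x1"

definition worst_case :: "('a \<Rightarrow> 'b pmf) \<Rightarrow> ('a \<Rightarrow> 'b \<Rightarrow> real) \<Rightarrow> 'a \<Rightarrow> real" where
  "worst_case q0 U2 x1 = Min (U2 x1 ` set_pmf (q0 x1))"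

definition minimax_solution :: "'a pmf \<Rightarrow> ('a \<Rightarrow> 'b pmf) \<Rightarrow> ('a \<Rightarrow> 'b \<Rightarrow> real) \<Rightarrow> 'a \<Rightarrow> bool" where
  "minimax_solution p0 q0 U2 x \<longleftrightarrow> is_arg_max (worst_case q0 U2) (\<lambda>x1. x1 \<in> set_pmf p0) x"

end

theory Submission
  imports Defs
begin

text \<open>
  For negative \<open>m\<close> the sum inside the certainty equivalent lies between its term at a worst
  response and \<open>exp (m * worst_case)\<close>, so the certainty equivalent tends to the worst case as
  \<open>m\<close> tends to minus infinity. Hence for each non-optimal action the exponent relative to the
  optimal one is eventually below a negative multiple of \<open>l\<close>, and the odds against the optimal
  action tend to zero; the policy is recovered from these odds by normalization.
\<close>

text \<open>The logarithm of the sum is bounded on both sides and then divided by the negative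
  \<open>m\<close>, which swaps the roles of the bounds. The price of keeping only one summand is
  its log-weight divided by \<open>m\<close>.\<close>

lemma certainty_equivalent_bounds:
  assumes fin: "finite (set_pmf (q0 x))" and m: "m < 0"
    and b: "b \<in> set_pmf (q0 x)" "U2 x b = worst_case q0 U2 x"
  shows "worst_case q0 U2 x \<le> certainty_equivalent q0 U2 m x"
    and "certainty_equivalent q0 U2 m x \<le> worst_case q0 U2 x + ln (pmf (q0 x) b) / m"
proof -
  define w where "w = worst_case q0 U2 x"
  define S where "S = (\<Sum>y\<in>set_pmf (q0 x). pmf (q0 x) y * exp (m * U2 x y))"
  have pos: "0 < pmf (q0 x) b"
    using b(1) by (rule pmf_positive)
  have w_le: "w \<le> U2 x y" if "y \<in> set_pmf (q0 x)" for y
    using fin that unfolding w_def worst_case_def by simp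
  \<comment> \<open>Since \<open>m\<close> is negative, the smallest utility \<open>w\<close> gives
    the largest exponential, and the weights sum to one.\<close>
  have "S \<le> (\<Sum>y\<in>set_pmf (q0 x). pmf (q0 x) y * exp (m * w))"
    unfolding S_def using w_le m
    by (intro sum_mono mult_left_mono) (simp_all add: mult_left_mono_neg)
  also have "\<dots> = exp (m * w)"
    using sum_pmf_eq_1[OF fin order_refl] by (simp flip: sum_distrib_right)
  finally have upper: "S \<le> exp (m * w)" .
  have lower: "pmf (q0 x) b * exp (m * w) \<le> S"
    using member_le_sum[OF b(1) _ fin, of "\<lambda>y. pmf (q0 x) y * exp (m * U2 x y)"] b(2)
    unfolding S_def w_def by simp
  have S_pos: "0 < S"
    using lower pos by (smt (verit) exp_gt_zero mult_pos_pos)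
  have "ln S \<le> m * w"
    using upper S_pos by (metis ln_exp ln_mono exp_gt_zero)
  moreover have "ln (pmf (q0 x) b) + m * w \<le> ln S"
    using ln_mono[OF lower] pos by (simp add: ln_mult)
  moreover have "certainty_equivalent q0 U2 m x = ln S / m"
    by (simp add: certainty_equivalent_def S_def)
  moreover have "w + ln (pmf (q0 x) b) / m = (ln (pmf (q0 x) b) + m * w) / m"
    using m by (simp add: add_divide_distrib)
  ultimately show "worst_case q0 U2 x \<le> certainty_equivalent q0 U2 m x"
    and "certainty_equivalent q0 U2 m x \<le> worst_case q0 U2 x + ln (pmf (q0 x) b) / m"
    using m unfolding w_def
    by (simp_all add: neg_le_divide_eq mult.commute divide_right_mono_neg)
qed

lemma certainty_equivalent_tendsto_worst_case:
  assumes fin: "finite (set_pmf (q0 x))"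
  shows "((\<lambda>m. certainty_equivalent q0 U2 m x) \<longlongrightarrow> worst_case q0 U2 x) at_bot"
proof -
  \<comment> \<open>The minimum over a finite nonempty support is attained. The witness
    \<open>b\<close> does not depend on \<open>m\<close>, so the error term
    \<open>ln (pmf (q0 x) b) / m\<close> has a constant numerator and vanishes.\<close>
  have "worst_case q0 U2 x \<in> U2 x ` set_pmf (q0 x)"
    unfolding worst_case_def using fin by (intro Min_in) (simp_all add: set_pmf_not_empty)
  then obtain b where b: "b \<in> set_pmf (q0 x)" "U2 x b = worst_case q0 U2 x"
    by auto
  have "((\<lambda>m. worst_case q0 U2 x + ln (pmf (q0 x) b) / m) \<longlongrightarrow> worst_case q0 U2 x + 0) at_bot"
    by (intro tendsto_intros tendsto_divide_0[OF tendsto_const]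
        filterlim_mono[OF filterlim_ident at_bot_le_at_infinity order_refl])
  then have upper_lim: "((\<lambda>m. worst_case q0 U2 x + ln (pmf (q0 x) b) / m) \<longlongrightarrow> worst_case q0 U2 x) at_bot"
    by simp
  have neg: "\<forall>\<^sub>F m in at_bot. m < (0::real)"
    by (rule eventually_gt_at_bot)
  show ?thesis
    by (rule tendsto_sandwich[OF _ _ tendsto_const upper_lim])
      (rule eventually_mono[OF neg], erule certainty_equivalent_bounds[OF fin _ b])+
qed

text \<open>Equal values of \<open>U1\<close> cancel in the ratio, leaving \<open>exp\<close> of
  \<open>l\<close> times a difference of certainty equivalents. That difference depends on
  \<open>m\<close> alone and has a strictly negative limit, so the product filter suffices: no order
  or relative rate of the two limits is imposed.\<close>

lemma unnormalized_policy_odds_tendsto_0: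
  assumes fin: "finite (set_pmf (q0 x))" "finite (set_pmf (q0 y))"
    and U1: "U1 x = U1 y"
    and less: "worst_case q0 U2 x < worst_case q0 U2 y"
  shows "((\<lambda>(l, m). unnormalized_policy p0 q0 U1 U2 l m x / unnormalized_policy p0 q0 U1 U2 l m y)
           \<longlongrightarrow> 0) (at_top \<times>\<^sub>F at_bot)"
proof -
  let ?ce = "certainty_equivalent q0 U2"
  let ?F = "at_top \<times>\<^sub>F at_bot :: (real \<times> real) filter"
  have ce: "((\<lambda>lm. ?ce (snd lm) z) \<longlongrightarrow> worst_case q0 U2 z) ?F" if "finite (set_pmf (q0 z))" for z
    by (rule filterlim_compose[OF certainty_equivalent_tendsto_worst_case[of q0, OF that] filterlim_snd])
  have "filterlim (\<lambda>lm. (?ce (snd lm) x - ?ce (snd lm) y) * fst lm) at_bot ?F"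
    by (rule filterlim_tendsto_neg_mult_at_bot[OF tendsto_diff[OF ce ce] _ filterlim_fst])
      (use fin less in auto)
  then have "((\<lambda>lm. pmf p0 x / pmf p0 y * exp ((?ce (snd lm) x - ?ce (snd lm) y) * fst lm))
      \<longlongrightarrow> 0) ?F"
    by (intro tendsto_mult_right_zero filterlim_compose[OF exp_at_bot])
  then show ?thesis
    by (simp add: unnormalized_policy_def case_prod_unfold U1 algebra_simps exp_add exp_diff)
qed

theorem mainTheorem4:
  fixes p0 :: "'a pmf" and q0 :: "'a \<Rightarrow> 'b pmf"
    and U1 :: "'a \<Rightarrow> real" and U2 :: "'a \<Rightarrow> 'b \<Rightarrow> real" and x_star :: 'a
  assumes "finite (set_pmf p0)"
    and "\<And>x1. x1 \<in> set_pmf p0 \<Longrightarrow> finite (set_pmf (q0 x1))"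
    and "\<And>x1. U1 x1 = 0"
    and "minimax_solution p0 q0 U2 x_star"
    and "\<And>x1. minimax_solution p0 q0 U2 x1 \<Longrightarrow> x1 = x_star"
  shows "\<forall>x1. ((\<lambda>(l, m). policy p0 q0 U1 U2 l m x1) \<longlongrightarrow> pmf (return_pmf x_star) x1)
                (at_top \<times>\<^sub>F at_bot)"
proof
  fix x
  let ?F = "at_top \<times>\<^sub>F at_bot :: (real \<times> real) filter"
  let ?u = "\<lambda>lm. unnormalized_policy p0 q0 U1 U2 (fst lm) (snd lm)"
  define r where "r z lm = ?u lm z / ?u lm x_star" for z lm
  have star: "x_star \<in> set_pmf p0"
    using assms(4) by (simp add: minimax_solution_def is_arg_max_def)
  have u_star: "?u lm x_star \<noteq> 0" for lm
    using pmf_positive[OF star] by (simp add: unnormalized_policy_def)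
  \<comment> \<open>If \<open>z\<close> did at least as well as \<open>x_star\<close>, it would be a
    maximizer too, against uniqueness.\<close>
  have less: "worst_case q0 U2 z < worst_case q0 U2 x_star"
    if "z \<in> set_pmf p0" "z \<noteq> x_star" for z
    using assms(4) assms(5)[of z] that unfolding minimax_solution_def is_arg_max_def
    by (meson not_less order_less_le_trans)
  have r_lim: "(r z \<longlongrightarrow> (if z = x_star then 1 else 0)) ?F" if z: "z \<in> set_pmf p0" for z
  proof (cases "z = x_star")
    case True
    then show ?thesis
      using u_star by (simp add: r_def[abs_def])
  next
    case False
    then show ?thesis
      using unnormalized_policy_odds_tendsto_0
          [where ?p0.0 = p0 and ?U1.0 = U1, OF assms(2)[OF z] assms(2)[OF star] _ less[OF z False]]
      by (simp add: r_def[abs_def] case_prod_unfold assms(3))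
  qed
  have "((\<lambda>lm. \<Sum>z\<in>set_pmf p0. r z lm) \<longlongrightarrow> (\<Sum>z\<in>set_pmf p0. if z = x_star then 1 else 0)) ?F"
    by (intro tendsto_sum r_lim)
  then have sum_lim: "((\<lambda>lm. \<Sum>z\<in>set_pmf p0. r z lm) \<longlongrightarrow> 1) ?F"
    using assms(1) star by simp
  \<comment> \<open>Numerator and partition sum are both divided by the nonzero weight of
    \<open>x_star\<close>.\<close>
  have policy_eq: "policy p0 q0 U1 U2 (fst lm) (snd lm) x = r x lm / (\<Sum>z\<in>set_pmf p0. r z lm)" for lm
    using u_star[of lm]
    by (simp add: policy_def partition_sum_def r_def flip: sum_divide_distrib)
  show "((\<lambda>(l, m). policy p0 q0 U1 U2 l m x) \<longlongrightarrow> pmf (return_pmf x_star) x) ?F"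
  proof (cases "x \<in> set_pmf p0")
    case True
    then show ?thesis
      using tendsto_divide[OF r_lim[OF True] sum_lim]
      by (simp add: case_prod_unfold policy_eq indicator_def of_bool_def eq_commute)
  next
    \<comment> \<open>Outside the support the policy is identically zero, and so is the point mass
      there, because \<open>x_star\<close> lies in the support.\<close>
    case False
    then have "x \<noteq> x_star"
      using star by blast
    with False show ?thesis
      by (simp add: policy_def unnormalized_policy_def set_pmf_iff case_prod_unfold)
  qed
qed

end
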